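(* Let $Q$ be a finite alphabet of size $q \ge 2$ and $Z$ a countable set. For a network $f : Q^Z \to Q^Z$ and $s \subseteq Z$, let $f^{(s)}(x) = (f_s(x), x_{Z \setminus s})$ and $f^{(s_1,\dots,s_k)} = f^{(s_k)} \circ \dots \circ f^{(s_1)}$. Call $f$ locally commutative if $f^{(i,j)} = f^{(j,i)}$ for all $i,j \in Z$, and globally commutative if $f^{(s,t)} = f^{(t,s)}$ for all $s,t \subseteq Z$. For $\phi : Q^Z \to Q$ and $x,y \in Q^Z$, a set $u \subseteq Z$ is an influence of $\phi$ for $(x,y)$ if $\phi(x_{Z\setminus u}, y_u) = \phi(y)$ and $\phi(x_{Z \setminus t}, y_t) \ne \phi(y)$ for every proper subset $t \subset u$. Consider the properties of $\phi$: (F1) for all $x,y$ there exists an influence of $\phi$ for $(x,y)$; (F2) for all $x,y$ there exists a finite influence of $\phi$ for $(x,y)$; (F3) there exists a finite $b \subseteq Z$ such that for all $x,y$ there exists an influence of $\phi$ for $(x,y)$ contained in $b$. A network satisfies (F1) (resp. (F2), (F3)) if every $f_i$, $i \in Z$, does. Then: (1) there exists a globally commutative network satisfying (F1) but not (F2); (2) there exists a globally commutative network satisfying (F2) but not (F3); (3) there exists a locally commutative network satisfying (F1) that is not globally commutative; (4) every locally commutative network satisfying (F2) is globally commutative.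
   Context: Automata networks $f: Q^Z \to Q^Z$ with $Q$ finite ($|Q| = q \ge 2$) and $Z$ countable; $x_s$ denotes the restriction of $x$ to $s$, and $(x_{Z\setminus u}, y_u)$ the configuration agreeing with $y$ on $u$ and with $x$ elsewhere.
   Formalization: In (1)–(3) the countable set Z is assumed infinite (and existence is shown for every such Z and every Q), since for finite Z every network satisfies (F1)–(F3) and these three claims fail; (4) is stated for every nonempty countable Z. *)

theory Defs
  imports "HOL-Library.Countable_Set"
begin

type_synonym ('z, 'q) config = "'z \<Rightarrow> 'q"
type_synonym ('z, 'q) network = "('z, 'q) config \<Rightarrow> ('z, 'q) config"

text \<open>
  The index set \<open>Z\<close> and the alphabet \<open>Q\<close> are types \<open>'z\<close> and \<open>'q\<close>.
  The configuration that agrees with \<open>y\<close> on \<open>u\<close> and with \<open>x\<close> elsewhere,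
  \<open>(x\<^bsub>Z\<setminus>u\<^esub>, y\<^bsub>u\<^esub>)\<close>, is \<^term>\<open>override_on x y u\<close>.
\<close>

definition update :: "('z, 'q) network \<Rightarrow> 'z set \<Rightarrow> ('z, 'q) network" where
  "update f s x = override_on x (f x) s"

text \<open>
  The head of the list is applied first:
  \<open>updates f [s\<^sub>1, \<dots>, s\<^sub>k] = update f s\<^sub>k \<circ> \<dots> \<circ> update f s\<^sub>1\<close>.
\<close>

definition updates :: "('z, 'q) network \<Rightarrow> 'z set list \<Rightarrow> ('z, 'q) network" where
  "updates f ss = fold (update f) ss"

definition locally_commutative :: "('z, 'q) network \<Rightarrow> bool" where
  "locally_commutative f \<longleftrightarrow> (\<forall>i j. updates f [{i}, {j}] = updates f [{j}, {i}])"

definition globally_commutative :: "('z, 'q) network \<Rightarrow> bool" where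
  "globally_commutative f \<longleftrightarrow> (\<forall>s t. updates f [s, t] = updates f [t, s])"

definition influence ::
    "(('z, 'q) config \<Rightarrow> 'q) \<Rightarrow> ('z, 'q) config \<Rightarrow> ('z, 'q) config \<Rightarrow> 'z set \<Rightarrow> bool" where
  "influence \<phi> x y u \<longleftrightarrow>
     \<phi> (override_on x y u) = \<phi> y \<and> (\<forall>t. t \<subset> u \<longrightarrow> \<phi> (override_on x y t) \<noteq> \<phi> y)"

definition F1 :: "(('z, 'q) config \<Rightarrow> 'q) \<Rightarrow> bool" where
  "F1 \<phi> \<longleftrightarrow> (\<forall>x y. \<exists>u. influence \<phi> x y u)"

definition F2 :: "(('z, 'q) config \<Rightarrow> 'q) \<Rightarrow> bool" where
  "F2 \<phi> \<longleftrightarrow> (\<forall>x y. \<exists>u. finite u \<and> influence \<phi> x y u)"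

definition F3 :: "(('z, 'q) config \<Rightarrow> 'q) \<Rightarrow> bool" where
  "F3 \<phi> \<longleftrightarrow> (\<exists>b. finite b \<and> (\<forall>x y. \<exists>u. u \<subseteq> b \<and> influence \<phi> x y u))"

definition network_satisfies ::
    "((('z, 'q) config \<Rightarrow> 'q) \<Rightarrow> bool) \<Rightarrow> ('z, 'q) network \<Rightarrow> bool" where
  "network_satisfies P f \<longleftrightarrow> (\<forall>i. P (\<lambda>x. f x i))"

end

theory Submission
  imports Defs
begin

text \<open>
  Changing a single coordinate at a time, local commutativity says that updating \<open>i\<close> does not alter
  \<open>f\<^sub>j\<close> for \<open>j \<noteq> i\<close>, and hence that updating any finite set avoiding \<open>j\<close> does not alter \<open>f\<^sub>j\<close>.
  A finite influence of \<open>f\<^sub>j\<close> for the pair \<open>(x, f\<^bsup>(s)\<^esup>(x))\<close> reduces an update along an arbitrary \<open>s\<close> to a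
  finite one, which gives (4).

  For (1) and (2), a network with a single node that is not the identity is globally commutative,
  whatever that node computes: a disjunction over all of \<open>Z\<close> for (1), and for (2) whether the first
  nonzero coordinate of \<open>x\<close> is immediately followed by another nonzero one. For (3), order \<open>Z\<close> like
  the natural numbers and let \<open>f\<^sub>i(x) = x\<^sub>i \<or> (\<exists>k > i. \<not> x\<^sub>k)\<close>. An update at \<open>j\<close> turns a zero into a one
  only if there is a later zero, so it never removes the last zero, whereas an infinite update can
  remove all zeros at once.
\<close>

section \<open>Updates and local commutativity\<close>

lemma update_apply: "update f s x k = (if k \<in> s then f x k else x k)"
  by (simp add: update_def override_on_def)

lemma updates_pair: "updates f [s, t] x = update f t (update f s x)"
  by (simp add: updates_def)

lemma globally_commutativeI:
  assumes "\<And>s t x. update f t (update f s x) = update f s (update f t x)"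
  shows "globally_commutative f"
  using assms by (auto simp: globally_commutative_def updates_pair fun_eq_iff[where f = "updates _ _"])

text \<open>The two orders can differ only at \<open>i\<close> and \<open>j\<close>. At
  \<open>j\<close> one order yields \<open>f (update f {i} x) j\<close> and the other
  \<open>f x j\<close>; node \<open>i\<close> is symmetric.\<close>

lemma locally_commutative_iff:
  "locally_commutative (f :: ('z, 'q) network) \<longleftrightarrow>
    (\<forall>i j x. i \<noteq> j \<longrightarrow> f (update f {i} x) j = f x j)"
proof
  assume L: "locally_commutative f"
  show "\<forall>i j x. i \<noteq> j \<longrightarrow> f (update f {i} x) j = f x j"
  proof (intro allI impI)
    fix i j :: 'z and x :: "('z, 'q) config" assume "i \<noteq> j"
    moreover have "updates f [{i}, {j}] x j = updates f [{j}, {i}] x j"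
      using L by (simp add: locally_commutative_def)
    ultimately show "f (update f {i} x) j = f x j"
      by (simp add: updates_pair update_apply)
  qed
next
  assume R: "\<forall>i j x. i \<noteq> j \<longrightarrow> f (update f {i} x) j = f x j"
  have "updates f [{i}, {j}] x k = updates f [{j}, {i}] x k" for i j k :: 'z and x
    using R by (cases "i = j") (auto simp: updates_pair update_apply)
  then show "locally_commutative f"
    by (auto simp: locally_commutative_def fun_eq_iff)
qed

section \<open>Influences and the three properties\<close>

lemma influence_empty: "\<phi> x = \<phi> y \<Longrightarrow> influence \<phi> x y {}"
  by (simp add: influence_def)

lemma influence_singleton:
  assumes "\<phi> x \<noteq> \<phi> y" "\<phi> (override_on x y {k}) = \<phi> y"
  shows "influence \<phi> x y {k}"
proof -
  have "t = {}" if "t \<subset> {k}" for t using that by blast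
  with assms show ?thesis unfolding influence_def by (metis override_on_emptyset)
qed

text \<open>Proper inclusion is well-founded on finite sets, so shrinking \<open>u\<close> ends at a
  minimal set.\<close>

lemma finite_influence_exists:
  assumes "finite u" "\<phi> (override_on x y u) = \<phi> y"
  shows "\<exists>v. finite v \<and> influence \<phi> x y v"
  using assms
proof (induction u rule: finite_psubset_induct)
  case (psubset u)
  show ?case
  proof (cases "\<exists>t. t \<subset> u \<and> \<phi> (override_on x y t) = \<phi> y")
    case True
    then show ?thesis using psubset.IH by blast
  next
    case False
    then show ?thesis using psubset.prems psubset.hyps by (auto simp: influence_def)
  qed
qed

text \<open>Minimality comes for free below a finite set, so later proofs only have to exhibit some
  finite \<open>u\<close>.\<close>

lemma F2_iff:
  "F2 \<phi> \<longleftrightarrow> (\<forall>x y. \<exists>u. finite u \<and> \<phi> (override_on x y u) = \<phi> y)"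
  unfolding F2_def using finite_influence_exists[of _ \<phi>] by (metis influence_def)

lemma F2_imp_F1: "F2 \<phi> \<Longrightarrow> F1 \<phi>"
  unfolding F1_def F2_def by blast

lemma F2_projection: "F2 (\<lambda>x. x i)"
  unfolding F2_iff by (auto intro!: exI[of _ "{i}"])

lemma F3_projection: "F3 (\<lambda>x. x i)"
proof -
  have "\<exists>u. u \<subseteq> {i} \<and> influence (\<lambda>x. x i) x y u" for x y :: "('a, 'b) config"
    by (cases "x i = y i") (auto simp: influence_def override_on_def)
  then show ?thesis unfolding F3_def by blast
qed

text \<open>To make the disjunction true, one true disjunct of \<open>y\<close> suffices. To make it
  false, all disjuncts true in \<open>x\<close> must be overwritten; omitting any one of them fails,
  even if they are infinitely many.\<close>

lemma F1_disjunction: "F1 (\<lambda>x. if \<exists>k\<in>K. P k (x k) then b else c)" (is "F1 ?\<phi>")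
  unfolding F1_def
proof (intro allI)
  fix x y
  show "\<exists>u. influence ?\<phi> x y u"
  proof (cases "?\<phi> x = ?\<phi> y")
    case True
    then have "influence ?\<phi> x y {}" by (rule influence_empty[of ?\<phi>])
    then show ?thesis ..
  next
    case neq: False
    show ?thesis
    proof (cases "\<exists>k\<in>K. P k (y k)")
      case True
      then obtain k where k: "k \<in> K" "P k (y k)" by blast
      then have "?\<phi> (override_on x y {k}) = ?\<phi> y"
        using True by (auto simp: override_on_def)
      with neq have "influence ?\<phi> x y {k}" by (rule influence_singleton[of ?\<phi>])
      then show ?thesis ..
    next
      case False
      define u where "u = {k \<in> K. P k (x k)}"
      have "?\<phi> (override_on x y u) = ?\<phi> y"
        using False by (auto simp: override_on_def u_def)
      moreover have "?\<phi> (override_on x y t) \<noteq> ?\<phi> y" if "t \<subset> u" for t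
      proof -
        from that obtain k where "k \<in> u" "k \<notin> t" by blast
        then have "k \<in> K" "P k (override_on x y t k)"
          by (auto simp: u_def)
        then have "\<exists>k\<in>K. P k (override_on x y t k)" by blast
        then show ?thesis using neq False by (auto split: if_splits)
      qed
      ultimately have "influence ?\<phi> x y u" by (simp add: influence_def)
      then show ?thesis ..
    qed
  qed
qed

section \<open>Networks with a single active node\<close>

definition single_node :: "'z \<Rightarrow> (('z, 'q) config \<Rightarrow> 'q) \<Rightarrow> ('z, 'q) network" where
  "single_node z \<phi> x = x(z := \<phi> x)"

lemma globally_commutative_single_node: "globally_commutative (single_node z \<phi>)"
proof (rule globally_commutativeI)
  \<comment> \<open>Every update is either the whole network or the identity, and these
    commute.\<close>
  have "update (single_node z \<phi>) s = (if z \<in> s then single_node z \<phi> else id)" for s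
    by (auto simp: fun_eq_iff update_apply single_node_def)
  then show "update (single_node z \<phi>) t (update (single_node z \<phi>) s x) =
      update (single_node z \<phi>) s (update (single_node z \<phi>) t x)" for s t x
    by simp
qed

lemma network_satisfies_single_node:
  assumes "\<And>i. P (\<lambda>x. x i)"
  shows "network_satisfies P (single_node z \<phi>) \<longleftrightarrow> P \<phi>"
proof -
  have "(\<lambda>x. single_node z \<phi> x i) = (if i = z then \<phi> else (\<lambda>x. x i))" for i
    by (auto simp: single_node_def)
  then show ?thesis using assms by (auto simp: network_satisfies_def)
qed

text \<open>Overwriting the constant \<open>b\<close> by \<open>a\<close> on finitely many nodes
  leaves some \<open>b\<close>, so the disjunction stays true.\<close>

lemma not_F2_disjunction:
  assumes "infinite (UNIV :: 'z set)" "b \<noteq> a"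
  shows "\<not> F2 (\<lambda>x :: ('z, 'q) config. if \<exists>k\<in>UNIV. x k \<noteq> a then b else a)" (is "\<not> F2 ?\<phi>")
proof
  assume "F2 ?\<phi>"
  then have "\<forall>x y. \<exists>u. finite u \<and> ?\<phi> (override_on x y u) = ?\<phi> y"
    unfolding F2_iff .
  from this[rule_format, of "\<lambda>_. b" "\<lambda>_. a"]
  obtain u where u: "finite u" "?\<phi> (override_on (\<lambda>_. b) (\<lambda>_. a) u) = ?\<phi> (\<lambda>_. a)"
    by (elim exE conjE)
  obtain k where "k \<notin> u" using assms(1) u(1) ex_new_if_finite by blast
  then have "override_on (\<lambda>_. b) (\<lambda>_. a) u k \<noteq> a"
    using assms(2) by simp
  then have "\<exists>k. override_on (\<lambda>_. b) (\<lambda>_. a) u k \<noteq> a" ..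
  then show False using u(2) assms(2) by simp
qed

text \<open>\<open>a\<close> acts as zero and all other symbols as nonzero; \<open>h\<close> orders
  the nodes.\<close>

definition first_followed :: "(nat \<Rightarrow> 'z) \<Rightarrow> 'q \<Rightarrow> 'q \<Rightarrow> ('z, 'q) config \<Rightarrow> 'q" where
  "first_followed h a b x =
    (if \<exists>n. (\<forall>m<n. x (h m) = a) \<and> x (h n) \<noteq> a \<and> x (h (Suc n)) \<noteq> a then b else a)"

text \<open>The index of the first nonzero coordinate is unique, so the existential collapses to one
  test at its successor.\<close>

lemma first_followed_eq:
  assumes "\<forall>m<n. x (h m) = a" "x (h n) \<noteq> a"
  shows "first_followed h a b x = (if x (h (Suc n)) \<noteq> a then b else a)"
proof -
  have "k = n" if "\<forall>m<k. x (h m) = a" "x (h k) \<noteq> a" for k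
    using assms that by (metis linorder_neqE_nat)
  then show ?thesis unfolding first_followed_def using assms by metis
qed

lemma first_nonzero:
  fixes h :: "nat \<Rightarrow> 'z"
  assumes "x (h n) \<noteq> a"
  obtains k where "\<forall>m<k. x (h m) = a" "x (h k) \<noteq> (a :: 'q)"
  using assms exists_least_iff[of "\<lambda>n. x (h n) \<noteq> a"] by blast

lemma first_followed_zero: "\<forall>n. x (h n) = a \<Longrightarrow> first_followed h a b x = a"
  by (simp add: first_followed_def)

lemma F2_first_followed:
  assumes "inj h"
  shows "F2 (first_followed h a b)"
  unfolding F2_iff
proof (intro allI)
  fix x y
  show "\<exists>u. finite u \<and> first_followed h a b (override_on x y u) = first_followed h a b y"
  proof (cases "\<forall>n. y (h n) = a")
    case y: True
    show ?thesis
    proof (cases "\<forall>n. x (h n) = a")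
      case True
      then show ?thesis using y by (auto intro!: exI[of _ "{}"] simp: first_followed_zero)
    next
      case False
      then obtain n where n: "\<forall>m<n. x (h m) = a" "x (h n) \<noteq> a"
        using first_nonzero[of x h _ a] by metis
      \<comment> \<open>The first nonzero coordinate of \<open>x\<close> stays in place, and its
        successor becomes zero.\<close>
      let ?z = "override_on x y {h (Suc n)}"
      have "h (Suc n) \<noteq> h n" using assms by (simp add: inj_eq)
      then have "first_followed h a b ?z = a"
        using n y first_followed_eq[of n ?z h a b] by (auto simp: override_on_def)
      then show ?thesis using y by (intro exI[of _ "{h (Suc n)}"]) (simp add: first_followed_zero)
    qed
  next
    case False
    then obtain n where n: "\<forall>m<n. y (h m) = a" "y (h n) \<noteq> a"
      using first_nonzero[of y h _ a] by metis
    \<comment> \<open>The bound is \<open>Suc n\<close> because the coordinate after the first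
      nonzero one decides the value.\<close>
    let ?u = "h ` {..Suc n}"
    have "override_on x y ?u (h m) = y (h m)" if "m \<le> Suc n" for m
      using that by (simp add: override_on_def)
    then have "first_followed h a b (override_on x y ?u) = first_followed h a b y"
      using n first_followed_eq[of n y h a b]
        first_followed_eq[of n "override_on x y ?u" h a b] by simp
    then show ?thesis by (intro exI[of _ ?u]) simp
  qed
qed

lemma not_F3_first_followed:
  fixes h :: "nat \<Rightarrow> 'z"
  assumes "inj h" "b \<noteq> a"
  shows "\<not> F3 (first_followed h a b)"
proof
  assume "F3 (first_followed h a b)"
  then obtain B where B: "finite B"
      "\<And>x y. \<exists>u. u \<subseteq> B \<and> influence (first_followed h a b) x y u"
    unfolding F3_def by blast
  have "finite (h -` B)" using B(1) assms(1) by (rule finite_vimageI)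
  \<comment> \<open>Two adjacent nonzero symbols from position \<open>N\<close> on are invisible to
    \<open>B\<close>.\<close>
  then obtain N where N: "\<And>m. m \<in> h -` B \<Longrightarrow> m < N"
    unfolding finite_nat_set_iff_bounded by auto
  define x where "x = (\<lambda>_ :: 'z. a)"
  define y where "y = x(h N := b, h (Suc N) := b)"
  obtain u where u: "u \<subseteq> B"
      "first_followed h a b (override_on x y u) = first_followed h a b y"
    using B(2)[of x y] by (auto simp: influence_def)
  have "h N \<notin> B" "h (Suc N) \<notin> B" using N[of N] N[of "Suc N"] by auto
  then have "override_on x y u = x"
    using u(1) by (auto simp: fun_eq_iff override_on_def y_def)
  moreover have "first_followed h a b x = a"
    by (simp add: first_followed_zero x_def)
  moreover have "first_followed h a b y = b"
    using first_followed_eq[of N y h a b] assms by (auto simp: y_def x_def inj_eq)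
  ultimately show False using u(2) assms(2) by simp
qed

section \<open>The network that looks for a later zero\<close>

definition later_zero :: "('z \<Rightarrow> nat) \<Rightarrow> 'q \<Rightarrow> 'q \<Rightarrow> ('z, 'q) network" where
  "later_zero g a b x i = (if x i \<noteq> a \<or> (\<exists>k. g i < g k \<and> x k = a) then b else a)"

lemma locally_commutative_later_zero:
  fixes g :: "'z \<Rightarrow> nat"
  assumes "b \<noteq> a"
  shows "locally_commutative (later_zero g a b)"
  unfolding locally_commutative_iff
proof (intro allI impI)
  fix i j :: 'z and x assume ij: "i \<noteq> j"
  let ?y = "update (later_zero g a b) {i} x"
  have zero_iff: "?y k = a \<longleftrightarrow> x k = a \<and> (k = i \<longrightarrow> \<not> (\<exists>l. g i < g l \<and> x l = a))" for k
    using assms by (auto simp: update_apply later_zero_def)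
  have "(\<exists>k. g j < g k \<and> ?y k = a) \<longleftrightarrow> (\<exists>k. g j < g k \<and> x k = a)"
  proof
    assume "\<exists>k. g j < g k \<and> x k = a"
    then obtain k where k: "g j < g k" "x k = a" by blast
    show "\<exists>k. g j < g k \<and> ?y k = a"
    proof (cases "k = i \<and> (\<exists>l. g i < g l \<and> x l = a)")
      case True
      \<comment> \<open>If the witness \<open>i\<close> itself is erased, the later zero
        \<open>l\<close> that caused this survives and replaces it.\<close>
      then obtain l where "g i < g l" "x l = a" by blast
      then show ?thesis using True k zero_iff[of l] by (intro exI[of _ l]) auto
    next
      case False
      then show ?thesis using k zero_iff by blast
    qed
  qed (use zero_iff in blast)
  moreover have "?y j = x j" using ij by (simp add: update_apply)
  ultimately show "later_zero g a b ?y j = later_zero g a b x j"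
    by (simp add: later_zero_def)
qed

lemma F1_later_zero:
  fixes g :: "'z \<Rightarrow> nat"
  shows "network_satisfies F1 (later_zero g a b)"
proof -
  \<comment> \<open>The equation between truth values encodes both kinds of disjunct:
    \<open>x i \<noteq> a\<close> at \<open>k = i\<close>, and \<open>x k = a\<close> at later
    nodes.\<close>
  have "(\<lambda>x. later_zero g a b x i) =
      (\<lambda>x. if \<exists>k\<in>{k. k = i \<or> g i < g k}. (x k = a) = (k \<noteq> i) then b else a)" for i
    by (fastforce simp: later_zero_def fun_eq_iff)
  moreover have "F1 (\<lambda>x. if \<exists>k\<in>K. (x k = a) = (k \<noteq> i) then b else a)" for K and i :: 'z
    by (rule F1_disjunction[where P = "\<lambda>k c. (c = a) = (k \<noteq> i)"])
  ultimately show ?thesis by (simp only: network_satisfies_def) simp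
qed

lemma not_globally_commutative_later_zero:
  fixes g :: "'z \<Rightarrow> nat"
  assumes "bij g" "b \<noteq> a"
  shows "\<not> globally_commutative (later_zero g a b)"
proof
  assume G: "globally_commutative (later_zero g a b)"
  let ?f = "later_zero g a b"
  obtain i where i: "g i = 0" using assms(1) by (metis bij_pointE)
  define x where "x = (\<lambda>_ :: 'z. a)"
  have later: "\<exists>k. g j < g k" for j
    using assms(1) by (metis bij_pointE lessI)
  \<comment> \<open>From the all-zero configuration, updating every node but the first erases all
    later zeros, so node \<open>i\<close> then computes \<open>a\<close>. Updated first, it computes
    \<open>b\<close>.\<close>
  have "updates ?f [- {i}, {i}] x i = updates ?f [{i}, - {i}] x i"
    using G by (simp add: globally_commutative_def)
  then have "?f (update ?f (- {i}) x) i = ?f x i"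
    by (simp add: updates_pair update_apply)
  moreover have "?f x j = b" for j using later[of j] by (simp add: later_zero_def x_def)
  moreover from this have "?f (update ?f (- {i}) x) i = a"
    using assms(2) by (auto simp: later_zero_def[of g a b "update _ _ _"] update_apply x_def)
  ultimately show False using assms(2) by simp
qed

section \<open>From local to global commutativity\<close>

lemma update_insert:
  assumes "f (update f t x) i = f x i" "i \<notin> t"
  shows "update f (insert i t) x = update f {i} (update f t x)"
  using assms by (auto simp: fun_eq_iff update_apply)

lemma locally_commutative_finite_update:
  assumes "locally_commutative f" "finite t" "j \<notin> t"
  shows "f (update f t x) j = f x j"
  using assms(2,3)
proof (induction t arbitrary: j rule: finite_induct)
  case empty
  then show ?case by (simp add: update_def)
next
  case (insert i t)
  \<comment> \<open>The induction hypothesis at node \<open>i\<close> instead of \<open>j\<close>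
    lets the update of \<open>i\<close> be postponed until after \<open>t\<close>.\<close>
  have "update f (insert i t) x = update f {i} (update f t x)"
    using insert.IH[OF insert.hyps(2)] insert.hyps(2) by (rule update_insert)
  then show ?case
    using insert.IH[of j] insert.prems assms(1) by (auto simp: locally_commutative_iff)
qed

lemma locally_commutative_F2_update:
  assumes L: "locally_commutative f" and F: "network_satisfies F2 f" and "j \<notin> s"
  shows "f (update f s x) j = f x j"
proof -
  from F obtain u where u: "finite u"
      "f (override_on x (update f s x) u) j = f (update f s x) j"
    unfolding network_satisfies_def F2_iff by meson
  \<comment> \<open>The two configurations agree outside \<open>s\<close>, so overriding on
    \<open>u\<close> is itself an update, along a finite set avoiding \<open>j\<close>.\<close>
  have "override_on x (update f s x) u = update f (s \<inter> u) x"
    by (auto simp: fun_eq_iff override_on_def update_apply)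
  moreover have "f (update f (s \<inter> u) x) j = f x j"
    using assms u(1) by (intro locally_commutative_finite_update) auto
  ultimately show ?thesis using u(2) by simp
qed

text \<open>Node \<open>j\<close> can be updated first, since this does not affect what the other
  nodes compute. The remaining update avoids \<open>j\<close> and so leaves its local function
  unchanged.\<close>

lemma locally_commutative_F2_update_mem:
  assumes L: "locally_commutative f" and F: "network_satisfies F2 f" and "j \<in> s"
  shows "f (update f s x) j = f (update f {j} x) j"
proof -
  have "update f s x = update f (s - {j}) (update f {j} x)"
    using L assms(3) by (auto simp: fun_eq_iff update_apply[of f s] update_apply[of f "s - {j}"]
        locally_commutative_iff update_apply[of f "{j}" x])
  then show ?thesis using locally_commutative_F2_update[OF L F, of j "s - {j}"] by simp
qed

lemma locally_commutative_F2_imp_globally_commutative: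
  assumes "locally_commutative f" "network_satisfies F2 f"
  shows "globally_commutative f"
proof (rule globally_commutativeI, rule ext)
  fix s t x k
  note out = locally_commutative_F2_update[OF assms, of k]
  note mem = locally_commutative_F2_update_mem[OF assms, of k]
  \<comment> \<open>If \<open>k\<close> lies in both sets, both orders give
    \<open>f (update f {k} x) k\<close>; if in exactly one, both give \<open>f x k\<close>.\<close>
  show "update f t (update f s x) k = update f s (update f t x) k"
    using out[of s x] out[of t x] mem[of s x] mem[of t x]
    by (cases "k \<in> s"; cases "k \<in> t") (simp_all add: update_apply[of f _ _ k])
qed

theorem theorem2:
  assumes "card (UNIV :: 'q::finite set) \<ge> 2"
    and "countable (UNIV :: 'z set)"
  shows "(infinite (UNIV :: 'z set) \<longrightarrow>
           (\<exists>f :: ('z, 'q) network.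
              globally_commutative f \<and> network_satisfies F1 f \<and> \<not> network_satisfies F2 f))
       \<and> (infinite (UNIV :: 'z set) \<longrightarrow>
           (\<exists>f :: ('z, 'q) network.
              globally_commutative f \<and> network_satisfies F2 f \<and> \<not> network_satisfies F3 f))
       \<and> (infinite (UNIV :: 'z set) \<longrightarrow>
           (\<exists>f :: ('z, 'q) network.
              locally_commutative f \<and> network_satisfies F1 f \<and> \<not> globally_commutative f))
       \<and> (\<forall>f :: ('z, 'q) network.
              locally_commutative f \<and> network_satisfies F2 f \<longrightarrow> globally_commutative f)"
proof (intro conjI impI)
  obtain a b :: 'q where ab: "b \<noteq> a"
    using assms(1) by (auto simp: numeral_2_eq_2 card_le_Suc_iff)
  {
    assume inf: "infinite (UNIV :: 'z set)"
    obtain h :: "nat \<Rightarrow> 'z" where h: "bij h"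
      using bij_betw_from_nat_into[OF assms(2) inf] by blast
    \<comment> \<open>An arbitrary node serves as the active one in the first two networks.\<close>
    fix z :: 'z
    define disj where "disj = (\<lambda>x :: ('z, 'q) config. if \<exists>k\<in>UNIV. x k \<noteq> a then b else a)"
    have "F1 disj" "\<not> F2 disj"
      unfolding disj_def by (rule F1_disjunction, rule not_F2_disjunction[OF inf ab])
    then have "network_satisfies F1 (single_node z disj)" "\<not> network_satisfies F2 (single_node z disj)"
      by (simp_all add: network_satisfies_single_node F2_projection F2_imp_F1)
    then show "\<exists>f :: ('z, 'q) network.
        globally_commutative f \<and> network_satisfies F1 f \<and> \<not> network_satisfies F2 f"
      by (intro exI[of _ "single_node z disj"] conjI globally_commutative_single_node)
    have "F2 (first_followed h a b)" "\<not> F3 (first_followed h a b)"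
      by (intro F2_first_followed not_F3_first_followed bij_is_inj h ab)+
    then have "network_satisfies F2 (single_node z (first_followed h a b))"
        "\<not> network_satisfies F3 (single_node z (first_followed h a b))"
      by (simp_all add: network_satisfies_single_node F2_projection F3_projection)
    then show "\<exists>f :: ('z, 'q) network.
        globally_commutative f \<and> network_satisfies F2 f \<and> \<not> network_satisfies F3 f"
      by (intro exI[of _ "single_node z (first_followed h a b)"] conjI
          globally_commutative_single_node)
    show "\<exists>f :: ('z, 'q) network.
        locally_commutative f \<and> network_satisfies F1 f \<and> \<not> globally_commutative f"
      by (intro exI[of _ "later_zero (inv h) a b"] conjI locally_commutative_later_zero
          F1_later_zero not_globally_commutative_later_zero bij_imp_bij_inv h ab)
  }
qed (use locally_commutative_F2_imp_globally_commutative in blast)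

end
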